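(* Let $V$ be a locally finite $\mathfrak B$-module and let $\mathbf B$ and $\mathbf B'$ be perfect bases of $V$ such that $\mathbf B'^+=\mathbf B^+$. Then the identity map $\mathrm{id}:V\to V$ defines an isomorphism of based $\mathfrak B$-modules $(V,\mathbf B)\to(V,\mathbf B')$; that is, there is a unique map $\tilde f:\mathbf B\to\mathbf B'$ and a unique function $c:\mathbf B\setminus\mathbf B^+\to\mathbb C^\times$, $b\mapsto c_b$, satisfying $\tilde f(b)=b$ for each $b\in\mathbf B^+$ and $$\tilde f(b)-c_b\,b\prec_{\mathbf i} b$$ for each $b\in\mathbf B\setminus\mathbf B^+$ and every sequence $\mathbf i$ such that $\tilde e_{\mathbf i}^{\,\mathrm{top}}(b)\in\mathbf B^+$. In particular, there is an isomorphism of (upper normal) Kashiwara crystals $\mathcal B(V,\mathbf B)\cong\mathcal B(V,\mathbf B')$.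
   Context: $I$ is a finite set, $\Lambda$ a lattice with dual lattice $\Lambda^\vee$ and evaluation pairing $\langle\cdot,\cdot\rangle:\Lambda\times\Lambda^\vee\to\mathbb Z$, with given elements $\alpha_i\in\Lambda$, $\alpha_i^\vee\in\Lambda^\vee$ ($i\in I$). $\mathfrak B$ is the associative $\mathbb C$-algebra generated by (commuting) $h_i$ and $e_i$, $i\in I$, with relations $h_ie_j-e_jh_i=\langle\alpha_i,\alpha_j^\vee\rangle e_j$ (the $e_i$ generate a free algebra). A $\mathfrak B$-module $V$ is locally finite if it has a weight decomposition $V=\bigoplus_{\mu\in\Lambda^\vee}V(\mu)$ (with $e_iV(\mu)\subset V(\mu+\alpha_i^\vee)$) and every cyclic submodule $\mathfrak B(v)$ is finite-dimensional. For $v\neq0$, $\ell_i(v)$ is the smallest integer $\ell\ge 0$ with $e_i^{\ell+1}(v)=0$ (the $e_i$ act locally nilpotently); $\ell_i(0)=-\infty$. $V_i^{<\ell}=\{v:e_i^\ell(v)=0\}$. $e_i^{\mathrm{top}}(v)=e_i^{\ell_i(v)}(v)$ and $e_{\mathbf i}^{\mathrm{top}}=e_{i_m}^{\mathrm{top}}\circ\cdots\circ e_{i_1}^{\mathrm{top}}$ for $\mathbf i=(i_1,\dots,i_m)$, $m\geq 1$. $V^+=\{v:e_i(v)=0\ \forall i\in I\}$. Standing property of locally finite modules used here: for every $v\ne0$ there is a sequence $\mathbf i$ with $e_{\mathbf i}^{\mathrm{top}}(v)\in V^+$. Pre-order $\preceq_{\mathbf i}$ on $V\setminus\{0\}$: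 for $\mathbf i=(i)$, $v\preceq_{\mathbf i}v'$ iff $\ell_i(v)\le\ell_i(v')$; for $\mathbf i=(i;\mathbf i')$, $v\preceq_{\mathbf i}v'$ iff $\ell_i(v)<\ell_i(v')$, or $\ell_i(v)=\ell_i(v')$ and $e_i^{\ell_i(v)}(v)\preceq_{\mathbf i'}e_i^{\ell_i(v)}(v')$. $v\equiv_{\mathbf i}v'$ means $v\preceq_{\mathbf i}v'$ and $v'\preceq_{\mathbf i}v$; $v\prec_{\mathbf i}v'$ means $v\preceq_{\mathbf i}v'$ and not $v\equiv_{\mathbf i}v'$; by convention $0\prec_{\mathbf i}v'$ for every $v'\neq 0$. A partial bijection of a set $A$ is a bijection between two subsets of $A$. A basis $\mathbf B$ of $V$ compatible with the weight decomposition is perfect if for each $i\in I$ there is a partial bijection $\tilde e_i:\mathbf B\to\mathbf B$ such that $\tilde e_i(b)$ is defined iff $e_i(b)\neq0$, and in that case $e_i(b)\in\mathbb C^\times\cdot\tilde e_i(b)+V_i^{<\ell_i(b)-1}$. The pair $(V,\mathbf B)$ is then a based $\mathfrak B$-module. $\mathbf B^+=\mathbf B\cap V^+$. $\tilde e_i^{\,\mathrm{top}}(b)=\tilde e_i^{\,\ell_i(b)}(b)$ and $\tilde e_{\mathbf i}^{\,\mathrm{top}}=\tilde e_{i_m}^{\,\mathrm{top}}\circ\cdots\circ\tilde e_{i_1}^{\,\mathrm{top}}$. A homomorphism of based modules $(V,\mathbf B)\to(V',\mathbf B')$ is a $\mathfrak B$-linear map $f:V\to V'$ with $0\notin f(\mathbf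 B)$ for which there are a map $\tilde f:\mathbf B\to\mathbf B'$ and a function $c:\mathbf B\setminus\mathbf B^+\to\mathbb C^\times$ with $\tilde f(b)=f(b)$ for $b\in\mathbf B^+$ and $f(b)-c_b\tilde f(b)\prec_{\mathbf i}f(b)$ for $b\in\mathbf B\setminus\mathbf B^+$ and any $\mathbf i$ with $e_{\mathbf i}^{\mathrm{top}}(b)\in V^+$ (for $f=\mathrm{id}$ this is the displayed condition after replacing $c_b$ by its inverse). The Kashiwara crystal $\mathcal B(V,\mathbf B)$ is the set $\mathbf B$ with the weight map $\tilde\gamma:\mathbf B\to\Lambda^\vee$, functions $\tilde\varepsilon_i=\ell_i$, $\tilde\varphi_i=\tilde\varepsilon_i+\langle\alpha_i,\tilde\gamma(\cdot)\rangle$, and partial bijections $\tilde e_i$. It is upper normal: $\tilde\varepsilon_i(b)=\max\{n\ge0:\tilde e_i^{\,n}(b)\text{ is defined}\}$. An isomorphism of such crystals is a bijection commuting with all $\tilde e_i$ and preserving $\tilde\gamma,\tilde\varphi_i,\tilde\varepsilon_i$. *)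

theory Defs
  imports Complex_Main "HOL-Library.FuncSet"
begin

(* A lattice: an abelian group isomorphic to Z^n for some n.  Z^n is realised as the group of
   integer sequences supported on {0..<n}. *)
class fg_free_ab_group = ab_group_add +
  assumes iso_Zn: "\<exists>n (\<psi> :: 'a \<Rightarrow> nat \<Rightarrow> int).
     bij_betw \<psi> UNIV {f. \<forall>k\<ge>n. f k = 0} \<and> (\<forall>x y k. \<psi> (x + y) k = \<psi> x k + \<psi> y k)"

typedef (overloaded) ('l::ab_group_add) dual =
    "{\<phi> :: 'l \<Rightarrow> int. \<forall>x y. \<phi> (x + y) = \<phi> x + \<phi> y}"
  morphisms eval_dual Abs_dual
  by (rule exI[of _ "\<lambda>_. 0"]) simp

setup_lifting type_definition_dual

instantiation dual :: (ab_group_add) ab_group_add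
begin

lift_definition zero_dual :: "'a dual" is "\<lambda>_. 0" by simp
lift_definition plus_dual :: "'a dual \<Rightarrow> 'a dual \<Rightarrow> 'a dual" is "\<lambda>f g x. f x + g x" by simp
lift_definition minus_dual :: "'a dual \<Rightarrow> 'a dual \<Rightarrow> 'a dual" is "\<lambda>f g x. f x - g x" by simp
lift_definition uminus_dual :: "'a dual \<Rightarrow> 'a dual" is "\<lambda>f x. - f x" by simp

instance by standard (transfer; simp add: fun_eq_iff)+

end

definition pairing :: "'l::ab_group_add \<Rightarrow> 'l dual \<Rightarrow> int" where
  "pairing x \<mu> = eval_dual \<mu> x"

(* The underlying space of a module is the whole type 'v.  The grading by weights is part of the
   data: the operators h_i alone do not determine it unless the alpha_i span the lattice
   rationally. *)
record (overloaded) ('i, 'l::ab_group_add, 'v) graded_module =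
  scl :: "complex \<Rightarrow> 'v \<Rightarrow> 'v"
  h_op :: "'i \<Rightarrow> 'v \<Rightarrow> 'v"
  e_op :: "'i \<Rightarrow> 'v \<Rightarrow> 'v"
  weight_space :: "'l dual \<Rightarrow> 'v set"

(* The algebra is given by generators and relations, so a module over it is a complex vector
   space with linear operators h_i, e_i that satisfy the relations. *)
definition is_module ::
  "'i set \<Rightarrow> ('i \<Rightarrow> 'l::ab_group_add) \<Rightarrow> ('i \<Rightarrow> 'l dual)
     \<Rightarrow> ('i, 'l, 'v::ab_group_add) graded_module \<Rightarrow> bool" where
  "is_module I \<alpha> \<alpha>v M \<longleftrightarrow>
     vector_space (scl M) \<and>
     (\<forall>i\<in>I. Vector_Spaces.linear (scl M) (scl M) (h_op M i)) \<and>
     (\<forall>i\<in>I. Vector_Spaces.linear (scl M) (scl M) (e_op M i)) \<and>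
     (\<forall>i\<in>I. \<forall>j\<in>I. \<forall>v. h_op M i (h_op M j v) = h_op M j (h_op M i v)) \<and>
     (\<forall>i\<in>I. \<forall>j\<in>I. \<forall>v. h_op M i (e_op M j v) - e_op M j (h_op M i v)
         = scl M (of_int (pairing (\<alpha> i) (\<alpha>v j))) (e_op M j v))"

definition is_submodule ::
  "'i set \<Rightarrow> ('i, 'l::ab_group_add, 'v::ab_group_add) graded_module \<Rightarrow> 'v set \<Rightarrow> bool" where
  "is_submodule I M N \<longleftrightarrow> module.subspace (scl M) N \<and>
     (\<forall>i\<in>I. h_op M i ` N \<subseteq> N \<and> e_op M i ` N \<subseteq> N)"

definition cyclic_submodule ::
  "'i set \<Rightarrow> ('i, 'l::ab_group_add, 'v::ab_group_add) graded_module \<Rightarrow> 'v \<Rightarrow> 'v set" where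
  "cyclic_submodule I M v = \<Inter>{N. is_submodule I M N \<and> v \<in> N}"

definition weight_decomposition ::
  "'i set \<Rightarrow> ('i \<Rightarrow> 'l::ab_group_add) \<Rightarrow> ('i \<Rightarrow> 'l dual)
     \<Rightarrow> ('i, 'l, 'v::ab_group_add) graded_module \<Rightarrow> bool" where
  "weight_decomposition I \<alpha> \<alpha>v M \<longleftrightarrow>
     (\<forall>\<mu>. module.subspace (scl M) (weight_space M \<mu>)) \<and>
     (\<forall>v. \<exists>!g. (\<forall>\<mu>. g \<mu> \<in> weight_space M \<mu>) \<and> finite {\<mu>. g \<mu> \<noteq> 0} \<and>
               v = (\<Sum>\<mu> | g \<mu> \<noteq> 0. g \<mu>)) \<and>
     (\<forall>i\<in>I. \<forall>\<mu>. \<forall>v\<in>weight_space M \<mu>. h_op M i v = scl M (of_int (pairing (\<alpha> i) \<mu>)) v) \<and>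
     (\<forall>i\<in>I. \<forall>\<mu>. e_op M i ` weight_space M \<mu> \<subseteq> weight_space M (\<mu> + \<alpha>v i))"

definition locally_finite_module ::
  "'i set \<Rightarrow> ('i \<Rightarrow> 'l::ab_group_add) \<Rightarrow> ('i \<Rightarrow> 'l dual)
     \<Rightarrow> ('i, 'l, 'v::ab_group_add) graded_module \<Rightarrow> bool" where
  "locally_finite_module I \<alpha> \<alpha>v M \<longleftrightarrow>
     is_module I \<alpha> \<alpha>v M \<and> weight_decomposition I \<alpha> \<alpha>v M \<and>
     (\<forall>v. \<exists>S. finite S \<and> cyclic_submodule I M v = module.span (scl M) S)"

(* Local nilpotence, and the property tops_reach_V_plus below, do not follow from local finiteness
   for arbitrary alpha_i and alpha_i^vee (take all of them 0, V = C and e_i = id), so both are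
   separate hypotheses. *)
definition locally_nilpotent ::
  "'i set \<Rightarrow> ('i, 'l::ab_group_add, 'v::ab_group_add) graded_module \<Rightarrow> bool" where
  "locally_nilpotent I M \<longleftrightarrow> (\<forall>i\<in>I. \<forall>v. \<exists>n. (e_op M i ^^ n) v = 0)"

(* Only meaningful for v \<noteq> 0 and e_i locally nilpotent.  The convention ell_i(0) = -infinity
   is built into prec below, the only place where v = 0 can occur. *)
definition ell :: "('i, 'l::ab_group_add, 'v::ab_group_add) graded_module \<Rightarrow> 'i \<Rightarrow> 'v \<Rightarrow> nat" where
  "ell M i v = (LEAST n. (e_op M i ^^ (n + 1)) v = 0)"

definition V_less ::
  "('i, 'l::ab_group_add, 'v::ab_group_add) graded_module \<Rightarrow> 'i \<Rightarrow> nat \<Rightarrow> 'v set" where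
  "V_less M i n = {v. (e_op M i ^^ n) v = 0}"

definition e_top :: "('i, 'l::ab_group_add, 'v::ab_group_add) graded_module \<Rightarrow> 'i \<Rightarrow> 'v \<Rightarrow> 'v" where
  "e_top M i v = (e_op M i ^^ ell M i v) v"

(* The head of the list acts first. *)
definition e_top_seq ::
  "('i, 'l::ab_group_add, 'v::ab_group_add) graded_module \<Rightarrow> 'i list \<Rightarrow> 'v \<Rightarrow> 'v" where
  "e_top_seq M is v = fold (e_top M) is v"

definition V_plus ::
  "'i set \<Rightarrow> ('i, 'l::ab_group_add, 'v::ab_group_add) graded_module \<Rightarrow> 'v set" where
  "V_plus I M = {v. \<forall>i\<in>I. e_op M i v = 0}"

(* For nonempty I, allowing the empty sequence changes nothing, because e_i^top fixes the nonzero
   elements of V^+; for I = {} it makes the property (trivially) true. *)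
definition tops_reach_V_plus ::
  "'i set \<Rightarrow> ('i, 'l::ab_group_add, 'v::ab_group_add) graded_module \<Rightarrow> bool" where
  "tops_reach_V_plus I M \<longleftrightarrow> (\<forall>v. v \<noteq> 0 \<longrightarrow> (\<exists>is\<in>lists I. e_top_seq M is v \<in> V_plus I M))"

definition sequences :: "'i set \<Rightarrow> 'i list set" where
  "sequences I = {is \<in> lists I. is \<noteq> []}"

(* The empty list is only the base of the recursion: the second clause at [i] says
   ell_i(v) \<le> ell_i(v'). *)
fun preceq ::
  "('i, 'l::ab_group_add, 'v::ab_group_add) graded_module \<Rightarrow> 'i list \<Rightarrow> 'v \<Rightarrow> 'v \<Rightarrow> bool" where
  "preceq M [] v v' \<longleftrightarrow> True"
| "preceq M (i # is) v v' \<longleftrightarrow> ell M i v < ell M i v' \<or>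
     (ell M i v = ell M i v' \<and>
      preceq M is ((e_op M i ^^ ell M i v) v) ((e_op M i ^^ ell M i v) v'))"

definition equiv_seq ::
  "('i, 'l::ab_group_add, 'v::ab_group_add) graded_module \<Rightarrow> 'i list \<Rightarrow> 'v \<Rightarrow> 'v \<Rightarrow> bool" where
  "equiv_seq M is v v' \<longleftrightarrow> preceq M is v v' \<and> preceq M is v' v"

definition prec ::
  "('i, 'l::ab_group_add, 'v::ab_group_add) graded_module \<Rightarrow> 'i list \<Rightarrow> 'v \<Rightarrow> 'v \<Rightarrow> bool" where
  "prec M is v v' \<longleftrightarrow> v' \<noteq> 0 \<and> (v = 0 \<or> preceq M is v v' \<and> \<not> equiv_seq M is v v')"

definition partial_bijection :: "'a set \<Rightarrow> ('a \<rightharpoonup> 'a) \<Rightarrow> bool" where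
  "partial_bijection A g \<longleftrightarrow> dom g \<subseteq> A \<and> ran g \<subseteq> A \<and> inj_on g (dom g)"

definition is_crystal_operator ::
  "('i, 'l::ab_group_add, 'v::ab_group_add) graded_module \<Rightarrow> 'v set \<Rightarrow> 'i \<Rightarrow> ('v \<rightharpoonup> 'v) \<Rightarrow> bool" where
  "is_crystal_operator M B i g \<longleftrightarrow> partial_bijection B g \<and>
     dom g = {b \<in> B. e_op M i b \<noteq> 0} \<and>
     (\<forall>b b'. g b = Some b' \<longrightarrow>
        (\<exists>c u. c \<noteq> 0 \<and> u \<in> V_less M i (ell M i b - 1) \<and> e_op M i b = scl M c b' + u))"

definition perfect_basis ::
  "'i set \<Rightarrow> ('i, 'l::ab_group_add, 'v::ab_group_add) graded_module \<Rightarrow> 'v set \<Rightarrow> bool" where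
  "perfect_basis I M B \<longleftrightarrow>
     \<not> module.dependent (scl M) B \<and> module.span (scl M) B = UNIV \<and>
     B \<subseteq> (\<Union>\<mu>. weight_space M \<mu>) \<and>
     (\<forall>i\<in>I. \<exists>g. is_crystal_operator M B i g)"

(* For a perfect basis the operator is unique, so the choice is harmless. *)
definition e_tilde ::
  "('i, 'l::ab_group_add, 'v::ab_group_add) graded_module \<Rightarrow> 'v set \<Rightarrow> 'i \<Rightarrow> ('v \<rightharpoonup> 'v)" where
  "e_tilde M B i = (SOME g. is_crystal_operator M B i g)"

fun partial_pow :: "('a \<rightharpoonup> 'a) \<Rightarrow> nat \<Rightarrow> ('a \<rightharpoonup> 'a)" where
  "partial_pow g 0 = Some"
| "partial_pow g (Suc n) = g \<circ>\<^sub>m partial_pow g n"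

definition e_tilde_top ::
  "('i, 'l::ab_group_add, 'v::ab_group_add) graded_module \<Rightarrow> 'v set \<Rightarrow> 'i \<Rightarrow> ('v \<rightharpoonup> 'v)" where
  "e_tilde_top M B i b = partial_pow (e_tilde M B i) (ell M i b) b"

fun e_tilde_top_seq ::
  "('i, 'l::ab_group_add, 'v::ab_group_add) graded_module \<Rightarrow> 'v set \<Rightarrow> 'i list \<Rightarrow> ('v \<rightharpoonup> 'v)" where
  "e_tilde_top_seq M B [] = Some"
| "e_tilde_top_seq M B (i # is) = e_tilde_top_seq M B is \<circ>\<^sub>m e_tilde_top M B i"

definition B_plus ::
  "'i set \<Rightarrow> ('i, 'l::ab_group_add, 'v::ab_group_add) graded_module \<Rightarrow> 'v set \<Rightarrow> 'v set" where
  "B_plus I M B = B \<inter> V_plus I M"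

definition module_hom ::
  "'i set \<Rightarrow> ('i, 'l::ab_group_add, 'v::ab_group_add) graded_module
     \<Rightarrow> ('i, 'l, 'w::ab_group_add) graded_module \<Rightarrow> ('v \<Rightarrow> 'w) \<Rightarrow> bool" where
  "module_hom I M M' f \<longleftrightarrow> Vector_Spaces.linear (scl M) (scl M') f \<and>
     (\<forall>i\<in>I. \<forall>v. f (h_op M i v) = h_op M' i (f v) \<and> f (e_op M i v) = e_op M' i (f v))"

definition based_hom ::
  "'i set \<Rightarrow> ('i, 'l::ab_group_add, 'v::ab_group_add) graded_module \<Rightarrow> 'v set
     \<Rightarrow> ('i, 'l, 'w::ab_group_add) graded_module \<Rightarrow> 'w set \<Rightarrow> ('v \<Rightarrow> 'w) \<Rightarrow> bool" where
  "based_hom I M B M' B' f \<longleftrightarrow> module_hom I M M' f \<and> 0 \<notin> f ` B \<and>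
     (\<exists>ft \<in> B \<rightarrow> B'. \<exists>c \<in> (B - B_plus I M B) \<rightarrow> - {0}.
        (\<forall>b\<in>B_plus I M B. ft b = f b) \<and>
        (\<forall>b\<in>B - B_plus I M B. \<forall>is\<in>sequences I. e_top_seq M is b \<in> V_plus I M \<longrightarrow>
            prec M' is (f b - scl M' (c b) (ft b)) (f b)))"

definition based_iso ::
  "'i set \<Rightarrow> ('i, 'l::ab_group_add, 'v::ab_group_add) graded_module \<Rightarrow> 'v set
     \<Rightarrow> ('i, 'l, 'w::ab_group_add) graded_module \<Rightarrow> 'w set \<Rightarrow> ('v \<Rightarrow> 'w) \<Rightarrow> bool" where
  "based_iso I M B M' B' f \<longleftrightarrow> based_hom I M B M' B' f \<and>
     (\<exists>g. based_hom I M' B' M B g \<and> g \<circ> f = id \<and> f \<circ> g = id)"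

record (overloaded) ('i, 'l::ab_group_add, 'b) crystal =
  elems :: "'b set"
  wt :: "'b \<Rightarrow> 'l dual"
  eps :: "'i \<Rightarrow> 'b \<Rightarrow> int"
  phi :: "'i \<Rightarrow> 'b \<Rightarrow> int"
  e_crys :: "'i \<Rightarrow> ('b \<rightharpoonup> 'b)"

definition weight ::
  "('i, 'l::ab_group_add, 'v::ab_group_add) graded_module \<Rightarrow> 'v \<Rightarrow> 'l dual" where
  "weight M v = (THE \<mu>. v \<in> weight_space M \<mu>)"

definition kashiwara_crystal ::
  "('i \<Rightarrow> 'l::ab_group_add) \<Rightarrow> ('i, 'l, 'v::ab_group_add) graded_module \<Rightarrow> 'v set
     \<Rightarrow> ('i, 'l, 'v) crystal" where
  "kashiwara_crystal \<alpha> M B =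
     \<lparr> elems = B,
       wt = weight M,
       eps = (\<lambda>i b. int (ell M i b)),
       phi = (\<lambda>i b. int (ell M i b) + pairing (\<alpha> i) (weight M b)),
       e_crys = e_tilde M B \<rparr>"

definition upper_normal :: "'i set \<Rightarrow> ('i, 'l::ab_group_add, 'b) crystal \<Rightarrow> bool" where
  "upper_normal I C \<longleftrightarrow> (\<forall>i\<in>I. \<forall>b\<in>elems C. \<exists>m.
     eps C i b = int m \<and> partial_pow (e_crys C i) m b \<noteq> None \<and>
     (\<forall>n. partial_pow (e_crys C i) n b \<noteq> None \<longrightarrow> n \<le> m))"

definition crystal_iso ::
  "'i set \<Rightarrow> ('i, 'l::ab_group_add, 'b) crystal \<Rightarrow> ('i, 'l, 'c) crystal \<Rightarrow> ('b \<Rightarrow> 'c) \<Rightarrow> bool" where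
  "crystal_iso I C C' f \<longleftrightarrow> bij_betw f (elems C) (elems C') \<and>
     (\<forall>b\<in>elems C. wt C' (f b) = wt C b) \<and>
     (\<forall>i\<in>I. \<forall>b\<in>elems C. eps C' i (f b) = eps C i b \<and> phi C' i (f b) = phi C i b \<and>
         e_crys C' i (f b) = map_option f (e_crys C i b))"

end

theory Submission
  imports Defs "HOL-Library.List_Lexorder"
begin

text \<open>
  For a perfect basis, \<open>e_top\<close> at \<open>i\<close> is injective, up to nonzero scalars, on the basis elements
  with a given value of \<open>ell\<close>. Hence \<open>ell\<close> of a vector is its maximum over the basis elements
  occurring in the vector, and by induction the same holds for the lexicographically ordered list
  \<open>ell_seq\<close> of these values along a sequence. If the top of \<open>b\<close> along a sequence lies in \<open>V_plus\<close>, it is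
  a multiple of a common element of \<open>B_plus\<close> of both bases, so linear independence of \<open>B'\<close> leaves
  exactly one \<open>b'\<close> in the expansion of \<open>b\<close> with the same \<open>ell_seq\<close> as \<open>b\<close>, and in turn \<open>b\<close> occurs in
  the expansion of \<open>b'\<close>. Two basis elements that occur in each other's expansions have the same
  \<open>ell_seq\<close> along every sequence, so \<open>b'\<close> does not depend on the chosen one.
\<close>

section \<open>The preorder as a lexicographic order\<close>

fun ell_seq :: "('i, 'l::ab_group_add, 'v::ab_group_add) graded_module \<Rightarrow> 'i list \<Rightarrow> 'v \<Rightarrow> nat list"
  where
  "ell_seq M [] v = []"
| "ell_seq M (i # is) v = ell M i v # ell_seq M is (e_top M i v)"

text \<open>In the recursive clause of \<open>preceq\<close> the two values of \<open>ell\<close>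
  agree, so both powers there are tops. The preorder is thus pulled back from a linear order on
  lists.\<close>

lemma preceq_iff_ell_seq: "preceq M is v w \<longleftrightarrow> ell_seq M is v \<le> ell_seq M is w"
  by (induction "is" arbitrary: v w) (auto simp: e_top_def)

text \<open>The case v = 0 stays separate: \<open>ell\<close> takes natural numbers, so the zero
  vector gets no list below all others.\<close>

lemma prec_iff_ell_seq:
  "prec M is v w \<longleftrightarrow> w \<noteq> 0 \<and> (v = 0 \<or> ell_seq M is v < ell_seq M is w)"
  by (auto simp: prec_def equiv_seq_def preceq_iff_ell_seq less_le_not_le)

lemma e_top_seq_simps [simp]:
  "e_top_seq M [] v = v"
  "e_top_seq M (i # is) v = e_top_seq M is (e_top M i v)"
  by (simp_all add: e_top_seq_def)

section \<open>Iterates of partial maps\<close>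

lemma partial_pow_add: "partial_pow g (m + n) x = Option.bind (partial_pow g n x) (partial_pow g m)"
  by (induction m) (auto simp: map_comp_def split: option.split Option.bind_splits)

lemma partial_pow_inj:
  assumes "inj_on g (dom g)" "partial_pow g n x = Some z" "partial_pow g n y = Some z"
  shows "x = y"
  using assms(2,3)
proof (induction n arbitrary: z)
  case (Suc n)
  then obtain x' y' where "partial_pow g n x = Some x'" "g x' = Some z"
    "partial_pow g n y = Some y'" "g y' = Some z"
    by (auto simp: map_comp_Some_iff)
  moreover from this have "x' = y'"
    using inj_onD[OF assms(1), of x' y'] by (auto simp: dom_def)
  ultimately show ?case using Suc.IH by simp
qed simp

section \<open>Locally nilpotent operators and their tops\<close>

locale nilpotent_operators = vector_space "scl M"
  for M :: "('i, 'l::ab_group_add, 'v::ab_group_add) graded_module" +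
  fixes I :: "'i set"
  assumes linear_e: "i \<in> I \<Longrightarrow> Vector_Spaces.linear (scl M) (scl M) (e_op M i)"
    and nilpotent: "locally_nilpotent I M"
begin

lemma linear_e_pow:
  assumes "i \<in> I"
  shows "Vector_Spaces.linear (scl M) (scl M) (e_op M i ^^ n)"
proof (induction n)
  case 0
  show ?case using vector_space_axioms by (simp add: Vector_Spaces.linear_iff)
next
  case (Suc n)
  then show ?case using linear_e[OF assms]
    by (simp add: Vector_Spaces.linear_iff)
qed

lemma e_pow_scale: "i \<in> I \<Longrightarrow> (e_op M i ^^ n) (scl M c v) = scl M c ((e_op M i ^^ n) v)"
  using linear_e_pow[of i n] by (simp add: Vector_Spaces.linear_iff)

lemma e_pow_add:
  "i \<in> I \<Longrightarrow> (e_op M i ^^ n) (v + w) = (e_op M i ^^ n) v + (e_op M i ^^ n) w"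
  using linear_e_pow[of i n] by (simp add: Vector_Spaces.linear_iff)

lemma e_pow_0: "i \<in> I \<Longrightarrow> (e_op M i ^^ n) 0 = 0"
  using e_pow_scale[of i n 0 0] by simp

lemma e_pow_sum: "i \<in> I \<Longrightarrow> (e_op M i ^^ n) (sum f A) = (\<Sum>a\<in>A. (e_op M i ^^ n) (f a))"
  by (induction A rule: infinite_finite_induct) (simp_all add: e_pow_0 e_pow_add)

lemma e_pow_mono:
  assumes "i \<in> I" "(e_op M i ^^ m) v = 0" "m \<le> n"
  shows "(e_op M i ^^ n) v = 0"
proof -
  have "(e_op M i ^^ (n - m + m)) v = 0"
    unfolding funpow_add using assms by (simp add: e_pow_0)
  then show ?thesis using assms(3) by simp
qed

lemma e_pow_Suc_ell:
  assumes "i \<in> I" shows "(e_op M i ^^ Suc (ell M i v)) v = 0"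
proof -
  obtain n where "(e_op M i ^^ n) v = 0"
    using nilpotent assms by (auto simp: locally_nilpotent_def)
  then have "(e_op M i ^^ (n + 1)) v = 0"
    by (rule e_pow_mono[OF assms]) simp
  then have "(e_op M i ^^ (ell M i v + 1)) v = 0"
    unfolding ell_def by (rule LeastI)
  then show ?thesis by simp
qed

lemma e_pow_eq_0_iff:
  assumes "i \<in> I" "v \<noteq> 0"
  shows "(e_op M i ^^ n) v = 0 \<longleftrightarrow> ell M i v < n"
proof
  assume *: "(e_op M i ^^ n) v = 0"
  then obtain m where m: "n = Suc m" using assms(2) by (cases n) auto
  then have "ell M i v \<le> m" unfolding ell_def using * by (intro Least_le) simp
  then show "ell M i v < n" by (simp add: m)
next
  assume "ell M i v < n"
  then show "(e_op M i ^^ n) v = 0"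
    using e_pow_mono[OF assms(1) e_pow_Suc_ell[OF assms(1)]] by simp
qed

lemma ell_eqI:
  assumes "i \<in> I" "(e_op M i ^^ n) v \<noteq> 0" "(e_op M i ^^ Suc n) v = 0"
  shows "ell M i v = n"
proof -
  have "v \<noteq> 0" using assms e_pow_0 by blast
  then show ?thesis using assms e_pow_eq_0_iff[OF assms(1), of v] by (metis less_Suc_eq)
qed

lemma ell_scale:
  assumes "i \<in> I" "c \<noteq> 0"
  shows "ell M i (scl M c v) = ell M i v"
  using assms by (simp add: ell_def e_pow_scale del: funpow.simps)

lemma e_top_scale:
  assumes "i \<in> I" "c \<noteq> 0"
  shows "e_top M i (scl M c v) = scl M c (e_top M i v)"
  using assms by (simp add: e_top_def ell_scale e_pow_scale)

lemma e_top_nonzero: "i \<in> I \<Longrightarrow> v \<noteq> 0 \<Longrightarrow> e_top M i v \<noteq> 0"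
  by (simp add: e_top_def e_pow_eq_0_iff)

lemma e_top_seq_nonzero: "is \<in> lists I \<Longrightarrow> v \<noteq> 0 \<Longrightarrow> e_top_seq M is v \<noteq> 0"
  by (induction "is" arbitrary: v) (auto simp: e_top_nonzero)

lemma e_top_seq_scale:
  "is \<in> lists I \<Longrightarrow> c \<noteq> 0 \<Longrightarrow> e_top_seq M is (scl M c v) = scl M c (e_top_seq M is v)"
  by (induction "is" arbitrary: v) (auto simp: e_top_scale)

lemma ell_seq_scale:
  "is \<in> lists I \<Longrightarrow> c \<noteq> 0 \<Longrightarrow> ell_seq M is (scl M c v) = ell_seq M is v"
  by (induction "is" arbitrary: v) (auto simp: e_top_scale ell_scale)

lemma scale_in_V_plus_iff:
  assumes "c \<noteq> 0" shows "scl M c v \<in> V_plus I M \<longleftrightarrow> v \<in> V_plus I M"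
  using assms e_pow_scale[of _ 1] by (auto simp: V_plus_def)

end

section \<open>Crystal operators of one perfect basis\<close>

locale perfect_module = nilpotent_operators M I
  for M :: "('i, 'l::ab_group_add, 'v::ab_group_add) graded_module" and I +
  fixes B :: "'v set"
  assumes perfect: "perfect_basis I M B"
begin

lemma independent_B: "independent B" and span_B: "span B = UNIV"
  using perfect by (auto simp: perfect_basis_def)

lemma nonzero_B: "b \<in> B \<Longrightarrow> b \<noteq> 0"
  using independent_B dependent_zero by blast

lemma representation_B:
  "representation B v b \<noteq> 0 \<Longrightarrow> b \<in> B"
  by (rule representation_ne_zero)

lemma e_tilde_crystal: "i \<in> I \<Longrightarrow> is_crystal_operator M B i (e_tilde M B i)"
  using perfect unfolding perfect_basis_def e_tilde_def by (metis someI_ex)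

lemma e_tilde_eq_None_iff:
  assumes "i \<in> I" "b \<in> B"
  shows "e_tilde M B i b = None \<longleftrightarrow> ell M i b = 0"
proof -
  have "e_tilde M B i b = None \<longleftrightarrow> (e_op M i ^^ 1) b = 0"
    using e_tilde_crystal[OF assms(1)] assms(2) domIff[of b "e_tilde M B i"]
    unfolding is_crystal_operator_def by auto
  then show ?thesis
    unfolding e_pow_eq_0_iff[OF assms(1) nonzero_B[OF assms(2)]] by simp
qed

text \<open>The error term u dies before the top power, so there only the multiple of b' survives.
  One more power kills b and u, hence b'. So \<open>ell\<close> falls by exactly one and the tops
  are proportional.\<close>

lemma e_tilde_SomeD:
  assumes "i \<in> I" "e_tilde M B i b = Some b'"
  shows "b \<in> B" "b' \<in> B" "ell M i b = Suc (ell M i b')"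
    "\<exists>c. c \<noteq> 0 \<and> e_top M i b = scl M c (e_top M i b')"
proof -
  note op = e_tilde_crystal[OF assms(1), unfolded is_crystal_operator_def partial_bijection_def]
  show b: "b \<in> B" and "b' \<in> B" using op assms(2) by (auto simp: dom_def ran_def)
  obtain c u where c: "c \<noteq> 0" and "u \<in> V_less M i (ell M i b - 1)"
    and eq: "e_op M i b = scl M c b' + u"
    using op assms(2) by blast
  then have u: "(e_op M i ^^ (ell M i b - 1)) u = 0" by (simp add: V_less_def)
  \<comment> \<open>With \<open>ell\<close> positive, the truncated difference
    \<open>ell M i b - 1\<close> is the true predecessor.\<close>
  have "ell M i b \<noteq> 0" using e_tilde_eq_None_iff[OF assms(1) b] assms(2) by simp
  then obtain m where m: "ell M i b = Suc m" using not0_implies_Suc by blast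
  have shift: "(e_op M i ^^ Suc n) b = scl M c ((e_op M i ^^ n) b') + (e_op M i ^^ n) u" for n
    by (simp add: funpow_Suc_right eq e_pow_add e_pow_scale assms(1) del: funpow.simps)
  have top: "(e_op M i ^^ Suc m) b = scl M c ((e_op M i ^^ m) b')"
    using shift[of m] u m by simp
  have "(e_op M i ^^ m) b' \<noteq> 0"
    using top e_top_nonzero[OF assms(1) nonzero_B[OF b]] m by (auto simp: e_top_def)
  moreover have "(e_op M i ^^ Suc m) u = 0" using e_pow_mono[OF assms(1) u, of "Suc m"] m by simp
  then have "(e_op M i ^^ Suc m) b' = 0"
    using shift[of "Suc m"] e_pow_Suc_ell[OF assms(1), of b] m c by simp
  ultimately have "ell M i b' = m" by (intro ell_eqI assms(1))
  then show "ell M i b = Suc (ell M i b')"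
    "\<exists>c. c \<noteq> 0 \<and> e_top M i b = scl M c (e_top M i b')"
    using m c top by (auto simp: e_top_def simp del: funpow.simps)
qed

lemma e_tilde_pow_defined:
  assumes "i \<in> I" "b \<in> B" "n \<le> ell M i b"
  shows "\<exists>t\<in>B. partial_pow (e_tilde M B i) n b = Some t \<and> ell M i b = n + ell M i t \<and>
    (\<exists>c. c \<noteq> 0 \<and> e_top M i b = scl M c (e_top M i t))"
  using assms(3)
proof (induction n)
  case 0
  show ?case using assms by (auto intro: exI[of _ 1])
next
  case (Suc n)
  then obtain t c where t: "t \<in> B" "partial_pow (e_tilde M B i) n b = Some t"
    "ell M i b = n + ell M i t" "c \<noteq> 0" "e_top M i b = scl M c (e_top M i t)"
    by auto
  then have "e_tilde M B i t \<noteq> None"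
    using Suc.prems e_tilde_eq_None_iff[OF assms(1) t(1)] by simp
  then obtain t' where t': "e_tilde M B i t = Some t'" by blast
  obtain d where "d \<noteq> 0" "e_top M i t = scl M d (e_top M i t')"
    using e_tilde_SomeD(4)[OF assms(1) t'] by blast
  then have "c * d \<noteq> 0 \<and> e_top M i b = scl M (c * d) (e_top M i t')"
    using t by simp
  then show ?case
    using e_tilde_SomeD(1-3)[OF assms(1) t'] t t'
    by (intro bexI[of _ t'] conjI exI[of _ "c * d"]) auto
qed

text \<open>The element reached after \<open>ell M i b\<close> steps has \<open>ell\<close> zero and
  is its own top.\<close>

lemma e_tilde_top_defined:
  assumes "i \<in> I" "b \<in> B"
  shows "\<exists>t\<in>B. \<exists>c. c \<noteq> 0 \<and> e_tilde_top M B i b = Some t \<and> e_top M i b = scl M c t"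
proof -
  obtain t where "t \<in> B" "e_tilde_top M B i b = Some t" "ell M i t = 0"
    "\<exists>c. c \<noteq> 0 \<and> e_top M i b = scl M c (e_top M i t)"
    using e_tilde_pow_defined[OF assms order_refl] by (auto simp: e_tilde_top_def)
  then show ?thesis by (auto simp: e_top_def[of M i t])
qed

text \<open>The element reached after \<open>ell M i b\<close> steps admits no further one, and an
  undefined iterate stays undefined.\<close>

lemma e_tilde_pow_undefined:
  assumes "i \<in> I" "b \<in> B" "ell M i b < n"
  shows "partial_pow (e_tilde M B i) n b = None"
proof -
  obtain t where "t \<in> B" "partial_pow (e_tilde M B i) (ell M i b) b = Some t" "ell M i t = 0"
    using e_tilde_pow_defined[OF assms(1,2) order_refl] by auto
  then have "partial_pow (e_tilde M B i) (Suc (ell M i b)) b = None"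
    using e_tilde_eq_None_iff[OF assms(1)] by simp
  moreover have "n = (n - Suc (ell M i b)) + Suc (ell M i b)" using assms(3) by simp
  ultimately show ?thesis
    using partial_pow_add[of "e_tilde M B i" "n - Suc (ell M i b)" "Suc (ell M i b)" b] by simp
qed

lemma upper_normal_kashiwara_crystal: "upper_normal I (kashiwara_crystal \<alpha> M B)"
  unfolding upper_normal_def
proof (intro ballI exI conjI allI impI)
  fix i b n
  assume i: "i \<in> I" and "b \<in> elems (kashiwara_crystal \<alpha> M B)"
  then have b: "b \<in> B" by (simp add: kashiwara_crystal_def)
  show "eps (kashiwara_crystal \<alpha> M B) i b = int (ell M i b)"
    by (simp add: kashiwara_crystal_def)
  show "partial_pow (e_crys (kashiwara_crystal \<alpha> M B) i) (ell M i b) b \<noteq> None"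
    using e_tilde_pow_defined[OF i b order_refl] by (auto simp: kashiwara_crystal_def)
  assume "partial_pow (e_crys (kashiwara_crystal \<alpha> M B) i) n b \<noteq> None"
  then show "n \<le> ell M i b"
    using e_tilde_pow_undefined[OF i b] by (force simp: kashiwara_crystal_def not_le[symmetric])
qed

text \<open>Equal values of \<open>ell\<close> make both tops the same iterate of one injective
  partial map.\<close>

lemma e_tilde_top_inj:
  assumes "i \<in> I" "ell M i b = ell M i b'"
    and "e_tilde_top M B i b = Some t" "e_tilde_top M B i b' = Some t"
  shows "b = b'"
  using assms e_tilde_crystal[OF assms(1)]
  by (auto simp: e_tilde_top_def is_crystal_operator_def partial_bijection_def
      intro: partial_pow_inj)

text \<open>Since \<open>ell\<close> drops by one, the remaining \<open>ell M i t\<close> steps from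
  t end where the \<open>ell M i b\<close> steps from b end.\<close>

lemma e_tilde_top_e_tilde:
  assumes "i \<in> I" "e_tilde M B i b = Some t"
  shows "e_tilde_top M B i b = e_tilde_top M B i t"
  using e_tilde_SomeD(3)[OF assms] partial_pow_add[of "e_tilde M B i" "ell M i t" 1 b] assms(2)
  by (simp add: e_tilde_top_def del: partial_pow.simps(2)) simp

section \<open>Expansions under powers of one operator\<close>

lemma representation_e_pow_basis:
  assumes "i \<in> I" "b \<in> B" "ell M i b \<le> m"
  shows "representation B ((e_op M i ^^ m) b) t \<noteq> 0 \<longleftrightarrow>
    ell M i b = m \<and> e_tilde_top M B i b = Some t"
proof (cases "ell M i b = m")
  case True
  obtain s c where s: "s \<in> B" "c \<noteq> 0" "e_tilde_top M B i b = Some s" "e_top M i b = scl M c s"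
    using e_tilde_top_defined[OF assms(1,2)] by blast
  then have "(e_op M i ^^ m) b = scl M c s" using True by (simp add: e_top_def)
  then show ?thesis
    using s True by (simp add: representation_scale representation_basis independent_B span_B)
next
  case False
  then have "(e_op M i ^^ m) b = 0"
    using assms by (simp add: e_pow_eq_0_iff nonzero_B)
  then show ?thesis using False by (simp add: representation_zero)
qed

lemma representation_e_pow:
  assumes "i \<in> I"
  shows "representation B ((e_op M i ^^ m) v) t =
    (\<Sum>b | representation B v b \<noteq> 0. representation B v b * representation B ((e_op M i ^^ m) b) t)"
proof -
  have "v = (\<Sum>b | representation B v b \<noteq> 0. scl M (representation B v b) b)"
    by (simp add: sum_nonzero_representation_eq independent_B span_B)
  then have "(e_op M i ^^ m) v =
      (\<Sum>b | representation B v b \<noteq> 0. scl M (representation B v b) ((e_op M i ^^ m) b))"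
    using e_pow_sum[OF assms] e_pow_scale[OF assms] by (metis (no_types, lifting) sum.cong)
  then show ?thesis
    by (simp add: representation_sum representation_scale independent_B span_B)
qed

text \<open>Nothing cancels: another a contributing to the coefficient at t would also have
  \<open>ell\<close> equal to m and top t, against \<open>e_tilde_top_inj\<close>.\<close>

lemma representation_e_pow_nonzero:
  assumes "i \<in> I" and le: "\<And>b. representation B v b \<noteq> 0 \<Longrightarrow> ell M i b \<le> m"
    and b: "representation B v b \<noteq> 0" "ell M i b = m" "e_tilde_top M B i b = Some t"
  shows "representation B ((e_op M i ^^ m) v) t \<noteq> 0"
proof -
  have "representation B ((e_op M i ^^ m) a) t = 0" if "representation B v a \<noteq> 0" "a \<noteq> b" for a
    using representation_e_pow_basis[OF assms(1) representation_B[OF that(1)] le[OF that(1)], of t]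
      e_tilde_top_inj[OF assms(1), of a b t] b(2,3) that(2) by auto
  then have "representation B ((e_op M i ^^ m) v) t =
      (\<Sum>a\<in>{b}. representation B v a * representation B ((e_op M i ^^ m) a) t)"
    using b(1) by (subst representation_e_pow[OF assms(1)], intro sum.mono_neutral_right) (auto simp: finite_representation)
  then show ?thesis
    using b representation_e_pow_basis[OF assms(1) representation_B[OF b(1)]] by simp
qed

text \<open>For m the largest \<open>ell\<close> among the occurring basis elements, the m-th power
  does not kill v, because the top of a maximal element survives without cancellation.\<close>

lemma ell_le:
  assumes "i \<in> I" "representation B v b \<noteq> 0"
  shows "ell M i b \<le> ell M i v"
proof -
  let ?S = "{b. representation B v b \<noteq> 0}"
  define m where "m = Max (ell M i ` ?S)"
  have fin: "finite ?S" by (rule finite_representation)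
  have le: "ell M i a \<le> m" if "representation B v a \<noteq> 0" for a
    unfolding m_def using fin that by (intro Max_ge) auto
  have "m \<in> ell M i ` ?S"
    unfolding m_def using fin assms(2) by (intro Max_in) auto
  then obtain a where a: "representation B v a \<noteq> 0" "ell M i a = m" by auto
  obtain t where "e_tilde_top M B i a = Some t"
    using e_tilde_top_defined[OF assms(1) representation_B[OF a(1)]] by blast
  then have "representation B ((e_op M i ^^ m) v) t \<noteq> 0"
    using representation_e_pow_nonzero[OF assms(1) le a] by blast
  then have "(e_op M i ^^ m) v \<noteq> 0" "v \<noteq> 0"
    using representation_zero a(1) by auto
  then show ?thesis
    using e_pow_eq_0_iff[OF assms(1)] le[OF assms(2)] by force
qed

lemma representation_e_top_nonzero:
  assumes "i \<in> I" "representation B v b \<noteq> 0" "ell M i b = ell M i v"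
    "e_tilde_top M B i b = Some t"
  shows "representation B (e_top M i v) t \<noteq> 0"
  unfolding e_top_def
  using assms ell_le[OF assms(1)] by (intro representation_e_pow_nonzero) auto

text \<open>A nonzero sum has a nonzero summand, and \<open>representation_e_pow_basis\<close> tells
  which basis elements give one.\<close>

lemma representation_e_topE:
  assumes "i \<in> I" "representation B (e_top M i v) t \<noteq> 0"
  obtains b where "representation B v b \<noteq> 0" "ell M i b = ell M i v"
    "e_tilde_top M B i b = Some t"
proof -
  have "(\<Sum>b | representation B v b \<noteq> 0.
      representation B v b * representation B ((e_op M i ^^ ell M i v) b) t) \<noteq> 0"
    using assms(2) representation_e_pow[OF assms(1), of "ell M i v" v t]
    by (simp only: e_top_def not_False_eq_True)
  then obtain b where b: "representation B v b \<noteq> 0"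
    "representation B ((e_op M i ^^ ell M i v) b) t \<noteq> 0"
    by (rule sum.not_neutral_contains_not_neutral) auto
  then show thesis
    using representation_e_pow_basis[OF assms(1) representation_B[OF b(1)] ell_le[OF assms(1) b(1)]]
      that by blast
qed

section \<open>Tops along sequences\<close>

lemma e_tilde_top_seq_defined:
  assumes "is \<in> lists I" "b \<in> B"
  shows "\<exists>t\<in>B. \<exists>c. c \<noteq> 0 \<and> e_tilde_top_seq M B is b = Some t \<and> e_top_seq M is b = scl M c t"
  using assms
proof (induction "is" arbitrary: b)
  case Nil
  then show ?case by (intro bexI[of _ b] exI[of _ 1]) auto
next
  case (Cons i "is")
  then have i: "i \<in> I" "is \<in> lists I" by auto
  obtain t c where t: "t \<in> B" "c \<noteq> 0" "e_tilde_top M B i b = Some t" "e_top M i b = scl M c t"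
    using e_tilde_top_defined i Cons.prems by blast
  obtain s d where s: "s \<in> B" "d \<noteq> 0" "e_tilde_top_seq M B is t = Some s"
    "e_top_seq M is t = scl M d s"
    using Cons.IH i t by blast
  have "e_top_seq M (i # is) b = scl M (c * d) s" "c * d \<noteq> 0"
    using t s i by (simp_all add: e_top_seq_scale)
  then show ?case using s t by (intro bexI[of _ s] exI[of _ "c * d"]) auto
qed

lemma ell_seq_Cons_basis:
  assumes "i \<in> I" "is \<in> lists I" "b \<in> B" "e_tilde_top M B i b = Some t"
  shows "ell_seq M (i # is) b = ell M i b # ell_seq M is t"
  using e_tilde_top_defined[OF assms(1,3)] assms(2,4) by (auto simp: ell_seq_scale[OF assms(2)])

text \<open>Injectivity is unwound from the last operator to the first: the tails of the lists give
  equality of the intermediate elements, then the heads give that of b and b'.\<close>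

lemma e_tilde_top_seq_inj:
  assumes "is \<in> lists I" "b \<in> B" "b' \<in> B" "ell_seq M is b = ell_seq M is b'"
    and "e_tilde_top_seq M B is b = Some t" "e_tilde_top_seq M B is b' = Some t"
  shows "b = b'"
  using assms
proof (induction "is" arbitrary: b b')
  case (Cons i "is")
  then have i: "i \<in> I" "is \<in> lists I" by auto
  obtain s s' where s: "s \<in> B" "e_tilde_top M B i b = Some s"
    "s' \<in> B" "e_tilde_top M B i b' = Some s'"
    using e_tilde_top_defined i(1) Cons.prems(1,2) by meson
  then have "ell M i b = ell M i b'" "ell_seq M is s = ell_seq M is s'"
    using Cons.prems ell_seq_Cons_basis[OF i] by (metis list.inject)+
  moreover have "s = s'"
    using Cons s i calculation(2) by (intro Cons.IH) auto
  ultimately show ?case using e_tilde_top_inj i s by blast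
qed simp

text \<open>Heads are compared by \<open>ell_le\<close>. Only if they agree do the tails matter, and
  then the top of b occurs in \<open>e_top M i v\<close>, so the induction hypothesis applies to
  it.\<close>

lemma ell_seq_le:
  assumes "is \<in> lists I" "representation B v b \<noteq> 0"
  shows "ell_seq M is b \<le> ell_seq M is v"
  using assms
proof (induction "is" arbitrary: v b)
  case (Cons i "is")
  then have i: "i \<in> I" "is \<in> lists I" by auto
  have b: "b \<in> B" using Cons.prems representation_B by blast
  obtain t where t: "e_tilde_top M B i b = Some t"
    using e_tilde_top_defined i b by blast
  have "ell_seq M is t \<le> ell_seq M is (e_top M i v)" if "ell M i b = ell M i v"
    using Cons.IH representation_e_top_nonzero[OF i(1) Cons.prems(1) that t] by blast
  then show ?case
    using ell_le[OF i(1) Cons.prems(1)] ell_seq_Cons_basis[OF i b t] by fastforce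
qed simp

lemma representation_e_top_seq_nonzero:
  assumes "is \<in> lists I" "representation B v b \<noteq> 0" "ell_seq M is b = ell_seq M is v"
    "e_tilde_top_seq M B is b = Some t"
  shows "representation B (e_top_seq M is v) t \<noteq> 0"
  using assms
proof (induction "is" arbitrary: v b)
  case (Cons i "is")
  then have i: "i \<in> I" "is \<in> lists I" by auto
  have b: "b \<in> B" using Cons.prems representation_B by blast
  obtain s where s: "e_tilde_top M B i b = Some s"
    using e_tilde_top_defined i b by blast
  show ?case
    using Cons i s ell_seq_Cons_basis[OF i b s]
      representation_e_top_nonzero[OF i(1) Cons.prems(1) _ s] by simp
qed simp

lemma representation_e_top_seqE:
  assumes "is \<in> lists I" "representation B (e_top_seq M is v) t \<noteq> 0"
  obtains b where "representation B v b \<noteq> 0" "ell_seq M is b = ell_seq M is v"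
    "e_tilde_top_seq M B is b = Some t"
  using assms
proof (induction "is" arbitrary: v thesis)
  case (Cons i "is")
  then have i: "i \<in> I" "is \<in> lists I" by auto
  obtain s where s: "representation B (e_top M i v) s \<noteq> 0"
    "ell_seq M is s = ell_seq M is (e_top M i v)" "e_tilde_top_seq M B is s = Some t"
    using Cons i by auto
  then obtain b where b: "representation B v b \<noteq> 0" "ell M i b = ell M i v"
    "e_tilde_top M B i b = Some s"
    using representation_e_topE i by metis
  then show ?case
    using Cons.prems(1)[of b] s ell_seq_Cons_basis[OF i representation_B[OF b(1)] b(3)] by simp
qed (simp add: representation_B)

lemma representation_nonzero_ex: "v \<noteq> 0 \<Longrightarrow> \<exists>b. representation B v b \<noteq> 0"
  using sum_nonzero_representation_eq[OF independent_B, of v] span_B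
  by (metis (mono_tags, lifting) UNIV_I empty_Collect_eq sum.empty)

section \<open>Weights of occurring basis elements\<close>

lemma homogeneous: "b \<in> B \<Longrightarrow> \<exists>\<mu>. b \<in> weight_space M \<mu>"
  using perfect by (auto simp: perfect_basis_def)

text \<open>Grouping the expansion of v by weight gives its weight decomposition. Uniqueness leaves
  only the part of weight \<mu>, and independence kills every coefficient at another weight.\<close>

lemma weight_eq:
  assumes dec: "weight_decomposition I \<alpha> \<alpha>v M"
    and v: "v \<noteq> 0" "v \<in> weight_space M \<mu>" and b: "representation B v b \<noteq> 0"
  shows "weight M b = weight M v"
proof -
  obtain w where w: "\<And>y. y \<in> B \<Longrightarrow> y \<in> weight_space M (w y)"
    using homogeneous by metis
  let ?S = "{y. representation B v y \<noteq> 0}"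
  have fin: "finite ?S" by (rule finite_representation)
  have sub: "subspace (weight_space M \<nu>)" for \<nu>
    using dec by (simp add: weight_decomposition_def)
  \<comment> \<open>The body of the unique existence in \<open>weight_decomposition\<close>, named
    so that uniqueness becomes a plain rule.\<close>
  define D where "D g u \<longleftrightarrow> (\<forall>\<nu>. g \<nu> \<in> weight_space M \<nu>) \<and> finite {\<nu>. g \<nu> \<noteq> 0} \<and>
    u = (\<Sum>\<nu> | g \<nu> \<noteq> 0. g \<nu>)" for g u
  have D_ex1: "\<exists>!g. D g u" for u
    unfolding D_def
    using dec[unfolded weight_decomposition_def, THEN conjunct2, THEN conjunct1] by (rule spec)
  have unique: "g = g'" if "D g u" "D g' u" for g g' u
  proof -
    obtain f where "\<And>h. D h u \<Longrightarrow> h = f" using D_ex1[of u] by blast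
    with that have "g = f" "g' = f" by iprover+
    then show ?thesis by simp
  qed
  have D_single: "D (\<lambda>\<kappa>. if \<kappa> = \<nu> then u else 0) u" if "u \<in> weight_space M \<nu>" for u \<nu>
  proof -
    have "(if \<kappa> = \<nu> then u else 0) \<in> weight_space M \<kappa>" for \<kappa>
      using that subspace_0[OF sub] by simp
    then show ?thesis by (cases "u = 0") (simp_all add: D_def)
  qed
  \<comment> \<open>A nonzero vector has only one weight, so the description in
    \<open>weight\<close> denotes it.\<close>
  have single: "u \<in> weight_space M \<nu> \<Longrightarrow> u \<noteq> 0 \<Longrightarrow> weight M u = \<nu>" for u \<nu>
  proof -
    assume u: "u \<in> weight_space M \<nu>" "u \<noteq> 0"
    have "\<xi> = \<nu>" if \<xi>: "u \<in> weight_space M \<xi>" for \<xi>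
    proof -
      have "(\<lambda>\<kappa>. if \<kappa> = \<nu> then u else 0) = (\<lambda>\<kappa>. if \<kappa> = \<xi> then u else 0)"
        by (rule unique[OF D_single[OF u(1)] D_single[OF \<xi>]])
      from fun_cong[OF this, of \<nu>] show ?thesis using u(2) by (simp split: if_splits)
    qed
    with u(1) show "weight M u = \<nu>" unfolding weight_def by (rule the_equality)
  qed
  \<comment> \<open>The candidate component of weight \<nu>, read off from the expansion of
    v.\<close>
  define g where "g \<nu> = (\<Sum>y | y \<in> ?S \<and> w y = \<nu>. scl M (representation B v y) y)" for \<nu>
  have g_supp: "{\<nu>. g \<nu> \<noteq> 0} \<subseteq> w ` ?S"
  proof
    fix \<nu> assume "\<nu> \<in> {\<nu>. g \<nu> \<noteq> 0}"
    then have "g \<nu> \<noteq> 0" by simp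
    then obtain y where "y \<in> {y. y \<in> ?S \<and> w y = \<nu>}"
      unfolding g_def by (rule sum.not_neutral_contains_not_neutral)
    then show "\<nu> \<in> w ` ?S" by blast
  qed
  have "D g v"
    unfolding D_def
  proof (intro conjI allI)
    show "g \<nu> \<in> weight_space M \<nu>" for \<nu>
      unfolding g_def using w representation_B
      by (intro subspace_sum[OF sub] subspace_scale[OF sub]) auto
    show "finite {\<nu>. g \<nu> \<noteq> 0}" using finite_subset[OF g_supp] fin by blast
    have "v = (\<Sum>y\<in>?S. scl M (representation B v y) y)"
      by (simp add: sum_nonzero_representation_eq independent_B span_B)
    also have "\<dots> = (\<Sum>\<nu>\<in>w ` ?S. g \<nu>)"
      unfolding g_def using fin by (rule sum.image_gen)
    also have "\<dots> = (\<Sum>\<nu> | g \<nu> \<noteq> 0. g \<nu>)"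
      using g_supp fin by (intro sum.mono_neutral_right) auto
    finally show "v = (\<Sum>\<nu> | g \<nu> \<noteq> 0. g \<nu>)" .
  qed
  then have "g = (\<lambda>\<nu>. if \<nu> = \<mu> then v else 0)"
    using D_single[OF v(2)] by (rule unique)
  then have g0: "g (w b) = 0" if "w b \<noteq> \<mu>" using that by simp
  have "w b = \<mu>"
  proof (rule ccontr)
    assume "w b \<noteq> \<mu>"
    then have 0: "(\<Sum>y | y \<in> ?S \<and> w y = w b. scl M (representation B v y) y) = 0"
      using g0 by (simp add: g_def)
    have "representation B v b = 0"
      by (rule independentD[OF independent_B _ _ 0]) (use fin b representation_B in auto)
    with b show False by simp
  qed
  moreover have "b \<in> B" using b by (rule representation_B)
  ultimately show ?thesis
    using single[OF v(2,1)] single[OF w nonzero_B, of b] by simp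
qed

text \<open>Some basis element occurs in the nonzero top of v; tracing it back gives b. Together
  with \<open>ell_seq_le\<close> this makes the list of v a maximum over its expansion.\<close>

lemma ell_seq_attained:
  assumes "is \<in> lists I" "v \<noteq> 0"
  obtains b where "representation B v b \<noteq> 0" "ell_seq M is b = ell_seq M is v"
  using representation_nonzero_ex[OF e_top_seq_nonzero[OF assms]] representation_e_top_seqE[OF assms(1)]
  by metis

end

section \<open>Matching two perfect bases\<close>

definition (in vector_space) linked :: "'b set \<Rightarrow> 'b set \<Rightarrow> 'b \<Rightarrow> 'b \<Rightarrow> bool" where
  "linked B B' b b' \<longleftrightarrow> representation B' b b' \<noteq> 0 \<and> representation B b' b \<noteq> 0"

locale two_perfect_bases = B: perfect_module M I B + B': perfect_module M I B'
  for M :: "('i, 'l::ab_group_add, 'v::ab_group_add) graded_module" and I B B' +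
  assumes tops_reach: "tops_reach_V_plus I M"
    and B_plus_eq: "B_plus I M B' = B_plus I M B"
begin

text \<open>The hypotheses are symmetric in the two bases. Exchanging the roles later yields
  bijectivity and the inverse homomorphism.\<close>

lemma swap: "two_perfect_bases M I B' B"
  by unfold_locales (simp_all add: tops_reach B_plus_eq)

lemma linked_sym: "B.linked B B' b b' \<longleftrightarrow> B.linked B' B b' b"
  by (auto simp: B.linked_def)

lemma linked_in: "B.linked B B' b b' \<Longrightarrow> b \<in> B \<and> b' \<in> B'"
  by (auto simp: B.linked_def B.representation_B B'.representation_B)

text \<open>Each element occurs in the other, so \<open>ell_seq_le\<close> applies both
  ways.\<close>

lemma linked_ell_seq:
  assumes "B.linked B B' b b'" "is \<in> lists I"
  shows "ell_seq M is b' = ell_seq M is b"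
  using assms(1) B.ell_seq_le[OF assms(2), of b' b] B'.ell_seq_le[OF assms(2), of b b']
  by (simp add: B.linked_def)

lemma linked_ell: "B.linked B B' b b' \<Longrightarrow> i \<in> I \<Longrightarrow> ell M i b' = ell M i b"
  using linked_ell_seq[of b b' "[i]"] by simp

text \<open>The theorem tests tops in the crystal, \<open>based_hom\<close> tops in the module; on
  basis elements they differ by a nonzero scalar.\<close>

lemma top_in_V_plus_iff:
  assumes "is \<in> lists I" "b \<in> B"
  shows "e_tilde_top_seq M B is b \<in> Some ` B_plus I M B \<longleftrightarrow> e_top_seq M is b \<in> V_plus I M"
  using B.e_tilde_top_seq_defined[OF assms] B.scale_in_V_plus_iff by (auto simp: B_plus_def)

lemma linked_via_top:
  assumes "is \<in> lists I" "b \<in> B" "e_top_seq M is b \<in> V_plus I M"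
  obtains b' where "B.linked B B' b b'"
    and "e_tilde_top_seq M B' is b' = e_tilde_top_seq M B is b"
    and "\<And>y. B.representation B' b y \<noteq> 0 \<Longrightarrow> y \<noteq> b' \<Longrightarrow> ell_seq M is y < ell_seq M is b"
proof -
  obtain t c where t: "t \<in> B" "c \<noteq> 0" "e_tilde_top_seq M B is b = Some t"
    "e_top_seq M is b = scl M c t"
    using B.e_tilde_top_seq_defined[OF assms(1,2)] by blast
  then have "t \<in> B_plus I M B"
    using assms(3) B.scale_in_V_plus_iff by (simp add: B_plus_def)
  then have t': "t \<in> B'" using B_plus_eq by (auto simp: B_plus_def)
  \<comment> \<open>The top of b is a multiple of t, which lies in both bases, so its expansion in
    \<open>B'\<close> has a single term.\<close>
  then have rep_top: "B.representation B' (e_top_seq M is b) = (\<lambda>y. if y = t then c else 0)"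
    using t by (auto simp: B.representation_scale B.representation_basis B'.independent_B B'.span_B)
  then obtain b' where b': "B.representation B' b b' \<noteq> 0" "ell_seq M is b' = ell_seq M is b"
    "e_tilde_top_seq M B' is b' = Some t"
    using B'.representation_e_top_seqE[OF assms(1), of b t] t(2) by auto
  have b'_in: "b' \<in> B'" using b'(1) by (rule B'.representation_B)
  \<comment> \<open>A y with the full \<open>ell_seq\<close> would pass its own top on to
    \<open>e_top_seq M is b\<close> without cancellation. That top can only be t, and injectivity
    gives y = b'.\<close>
  have less: "ell_seq M is y < ell_seq M is b" if y: "B.representation B' b y \<noteq> 0" "y \<noteq> b'" for y
  proof (rule ccontr)
    assume "\<not> ell_seq M is y < ell_seq M is b"
    then have eq: "ell_seq M is y = ell_seq M is b"
      using B'.ell_seq_le[OF assms(1) y(1)] by simp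
    have y_in: "y \<in> B'" using y(1) by (rule B'.representation_B)
    obtain s where s: "e_tilde_top_seq M B' is y = Some s"
      using B'.e_tilde_top_seq_defined[OF assms(1) y_in] by blast
    then have "s = t"
      using B'.representation_e_top_seq_nonzero[OF assms(1) y(1) eq] rep_top
      by (auto split: if_splits)
    then show False
      using B'.e_tilde_top_seq_inj[OF assms(1) y_in b'_in _ _ b'(3)] eq b'(2) s y(2) by simp
  qed
  \<comment> \<open>Subtracting a times b' removes b' from the expansion in \<open>B'\<close> and
    leaves only smaller terms. If b did not occur in b', it would still occur in z and force z to be
    at least as large as b.\<close>
  define a where "a = B.representation B' b b'"
  define z where "z = b - scl M a b'"
  have "B.representation B b' b \<noteq> 0"
  proof
    assume "B.representation B b' b = 0"
    then have "B.representation B z b \<noteq> 0"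
      using assms(2)
      by (simp add: z_def B.representation_diff B.representation_scale B.representation_basis
          B.independent_B B.span_B)
    then have z: "ell_seq M is b \<le> ell_seq M is z" "z \<noteq> 0"
      using B.ell_seq_le[OF assms(1)] by (auto simp: B.representation_zero)
    obtain y where y: "B.representation B' z y \<noteq> 0" "ell_seq M is y = ell_seq M is z"
      using B'.ell_seq_attained[OF assms(1) z(2)] .
    then have "B.representation B' b y \<noteq> 0" "y \<noteq> b'"
      using b'_in
      by (auto simp: z_def a_def B.representation_diff B.representation_scale
          B.representation_basis B'.independent_B B'.span_B split: if_splits)
    then show False using less[of y] y(2) z(1) by simp
  qed
  then show thesis using that b' t(3) less by (simp add: B.linked_def)
qed

text \<open>Linked elements have equal \<open>ell_seq\<close>, while all other terms of b are
  strictly smaller. One sequence reaching \<open>V_plus\<close> therefore decides both existence and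
  uniqueness.\<close>

lemma linked_ex1:
  assumes "b \<in> B"
  shows "\<exists>!b'. B.linked B B' b b'"
proof -
  obtain "is" where sq: "is \<in> lists I" "e_top_seq M is b \<in> V_plus I M"
    using tops_reach B.nonzero_B[OF assms] by (auto simp: tops_reach_V_plus_def)
  obtain b' where b': "B.linked B B' b b'"
    "\<And>y. B.representation B' b y \<noteq> 0 \<Longrightarrow> y \<noteq> b' \<Longrightarrow> ell_seq M is y < ell_seq M is b"
    using linked_via_top[OF sq(1) assms sq(2)] by metis
  have "y = b'" if "B.linked B B' b y" for y
    using b'(2)[of y] linked_ell_seq[OF that sq(1)] that by (auto simp: B.linked_def)
  with b'(1) show ?thesis by blast
qed

lemma linked_unique:
  "B.linked B B' b b' \<Longrightarrow> B.linked B B' b b'' \<Longrightarrow> b' = b''"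
  using linked_ex1 linked_in by blast

text \<open>The b' of \<open>linked_via_top\<close> comes from a given sequence; by uniqueness it is
  the same for every admissible one, so its properties carry over.\<close>

lemma linked_tops:
  assumes "B.linked B B' b b'" "is \<in> lists I" "e_top_seq M is b \<in> V_plus I M"
  shows "e_tilde_top_seq M B' is b' = e_tilde_top_seq M B is b"
  using linked_via_top[OF assms(2) _ assms(3)] linked_in linked_unique assms(1) by metis

lemma linked_less:
  assumes "B.linked B B' b b'" "is \<in> lists I" "e_top_seq M is b \<in> V_plus I M"
    and "B.representation B' b y \<noteq> 0" "y \<noteq> b'"
  shows "ell_seq M is y < ell_seq M is b"
  using linked_via_top[OF assms(2) _ assms(3)] linked_in linked_unique assms(1,4,5) by metis

section \<open>Leading terms and their coefficients\<close>

lemma linked_B_plus: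
  assumes "b \<in> B_plus I M B"
  shows "B.linked B B' b b"
proof -
  have "b \<in> B" "b \<in> B'" using assms B_plus_eq by (auto simp: B_plus_def)
  then show ?thesis
    by (simp add: B.linked_def B.representation_basis B.independent_B B'.independent_B)
qed

text \<open>The chosen coefficient cancels b' in the difference. By \<open>linked_less\<close> the
  remaining terms are smaller, and \<open>ell_seq\<close> of the difference is attained on one of
  them.\<close>

lemma linked_prec:
  assumes "B.linked B B' b b'" "is \<in> lists I" "e_top_seq M is b \<in> V_plus I M"
  shows "prec M is (b - scl M (B.representation B' b b') b') b"
proof -
  define z where "z = b - scl M (B.representation B' b b') b'"
  have b: "b \<in> B" "b' \<in> B'" using linked_in[OF assms(1)] by simp_all
  have "ell_seq M is z < ell_seq M is b" if z: "z \<noteq> 0"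
  proof -
    obtain y where y: "B.representation B' z y \<noteq> 0" "ell_seq M is y = ell_seq M is z"
      using B'.ell_seq_attained[OF assms(2) z] .
    then have "B.representation B' b y \<noteq> 0" "y \<noteq> b'"
      using b
      by (auto simp: z_def B.representation_diff B.representation_scale
          B.representation_basis B'.independent_B B'.span_B split: if_splits)
    then show ?thesis using linked_less[OF assms] y(2) by metis
  qed
  then show ?thesis
    unfolding z_def[symmetric] prec_iff_ell_seq using B.nonzero_B[OF b(1)] by blast
qed

text \<open>\<open>based_hom\<close> subtracts a multiple of b' from b, the theorem a multiple of b
  from b'. The two differences are proportional, with factor -1/a.\<close>

lemma linked_prec_inverse:
  assumes "B.linked B B' b b'" "is \<in> lists I" "e_top_seq M is b \<in> V_plus I M"
  shows "prec M is (b' - scl M (1 / B.representation B' b b') b) b"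
proof -
  define a where "a = B.representation B' b b'"
  have a: "a \<noteq> 0" using assms(1) by (simp add: a_def B.linked_def)
  then have "b' - scl M (1 / a) b = scl M (- 1 / a) (b - scl M a b')"
    by (simp add: B.scale_right_diff_distrib)
  then show ?thesis
    using linked_prec[OF assms] a B.ell_seq_scale[OF assms(2), of "- 1 / a"]
    unfolding a_def[symmetric] prec_iff_ell_seq
    by (metis B.scale_zero_right divide_eq_0_iff neg_equal_0_iff_equal one_neq_zero)
qed

text \<open>The coefficient of b' in y - c b must vanish, since b' is as large as b and the
  difference is smaller. The contribution of c b is nonzero, so y itself has to supply the
  cancelling term.\<close>

lemma prec_determines:
  assumes "B.linked B B' b b'" "is \<in> lists I" "e_top_seq M is b \<in> V_plus I M"
    and "y \<in> B'" "c \<noteq> 0" "prec M is (y - scl M c b) b"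
  shows "y = b' \<and> c = 1 / B.representation B' b b'"
proof -
  define z where "z = y - scl M c b"
  have "B.representation B' z b' = 0"
  proof (rule ccontr)
    assume nz: "B.representation B' z b' \<noteq> 0"
    then have "z \<noteq> 0" by (auto simp: B.representation_zero)
    then have "ell_seq M is z < ell_seq M is b"
      using assms(6) by (simp add: z_def prec_iff_ell_seq)
    then show False
      using B'.ell_seq_le[OF assms(2) nz] linked_ell_seq[OF assms(1,2)] by simp
  qed
  moreover have "B.representation B' z b' = (if b' = y then 1 else 0) - c * B.representation B' b b'"
    using assms(4)
    by (simp add: z_def B.representation_diff B.representation_scale B.representation_basis
        B'.independent_B B'.span_B)
  moreover have "B.representation B' b b' \<noteq> 0" using assms(1) by (simp add: B.linked_def)
  ultimately show ?thesis using assms(5) by (auto simp: field_simps split: if_splits)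
qed

section \<open>Compatibility with the crystal operators\<close>

lemma linked_e_tilde:
  assumes "B.linked B B' b b'" "i \<in> I" "e_tilde M B i b = Some t"
  shows "\<exists>t'. e_tilde M B' i b' = Some t' \<and> B.linked B B' t t'"
proof -
  have b: "b \<in> B" "b' \<in> B'" using linked_in[OF assms(1)] by simp_all
  have t: "t \<in> B" "ell M i b = Suc (ell M i t)"
    using B.e_tilde_SomeD[OF assms(2,3)] by simp_all
  then have "e_tilde M B' i b' \<noteq> None"
    using linked_ell[OF assms(1,2)] B'.e_tilde_eq_None_iff[OF assms(2) b(2)] by simp
  then obtain t' where t': "e_tilde M B' i b' = Some t'" by blast
  have t'_in: "t' \<in> B'" using B'.e_tilde_SomeD[OF assms(2) t'] by simp
  \<comment> \<open>The sequence is made to begin with \<open>i\<close>: taking \<open>e_top\<close>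
    at \<open>i\<close> turns b and t, and likewise b' and t', into proportional vectors, so one
    sequence serves both pairs.\<close>
  obtain "is" where sq: "is \<in> lists I" "e_top_seq M is (e_top M i b) \<in> V_plus I M"
    using tops_reach B.e_top_nonzero[OF assms(2) B.nonzero_B[OF b(1)]]
    by (auto simp: tops_reach_V_plus_def)
  let ?is = "i # is"
  have is': "?is \<in> lists I" using assms(2) sq(1) by simp
  obtain c where c: "c \<noteq> 0" "e_top M i b = scl M c (e_top M i t)"
    using B.e_tilde_SomeD(4)[OF assms(2,3)] by blast
  obtain c' where c': "c' \<noteq> 0" "e_top M i b' = scl M c' (e_top M i t')"
    using B'.e_tilde_SomeD(4)[OF assms(2) t'] by blast
  have top_b: "e_top_seq M ?is b \<in> V_plus I M" using sq(2) by simp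
  then have top_t: "e_top_seq M ?is t \<in> V_plus I M"
    using c B.e_top_seq_scale[OF sq(1)] B.scale_in_V_plus_iff by simp
  \<comment> \<open>The partner s of t is identified with t' by injectivity: both lie in
    \<open>B'\<close> and share \<open>ell_seq\<close> and the crystal top.\<close>
  obtain s where s: "B.linked B B' t s" using linked_ex1[OF t(1)] by blast
  have s_in: "s \<in> B'" using linked_in[OF s] by simp
  have "ell_seq M ?is s = ell_seq M ?is t'"
  proof -
    have "ell_seq M ?is b' = ell_seq M ?is b" "ell_seq M ?is s = ell_seq M ?is t"
      using linked_ell_seq[OF assms(1) is'] linked_ell_seq[OF s is'] by simp_all
    moreover have "ell M i t = ell M i t'"
      using t(2) B'.e_tilde_SomeD(3)[OF assms(2) t'] linked_ell[OF assms(1,2)] by simp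
    ultimately show ?thesis using c c' B.ell_seq_scale[OF sq(1)] by simp
  qed
  moreover have "e_tilde_top_seq M B' ?is s = e_tilde_top_seq M B' ?is t'"
  proof -
    have "e_tilde_top_seq M B' ?is s = e_tilde_top_seq M B ?is t"
      by (rule linked_tops[OF s is' top_t])
    also have "\<dots> = e_tilde_top_seq M B ?is b"
      by (simp add: map_comp_def B.e_tilde_top_e_tilde[OF assms(2,3)])
    also have "\<dots> = e_tilde_top_seq M B' ?is b'"
      by (rule linked_tops[OF assms(1) is' top_b, symmetric])
    also have "\<dots> = e_tilde_top_seq M B' ?is t'"
      by (simp add: map_comp_def B'.e_tilde_top_e_tilde[OF assms(2) t'])
    finally show ?thesis .
  qed
  ultimately have "s = t'"
    using B'.e_tilde_top_seq_inj[OF is' s_in t'_in] B'.e_tilde_top_seq_defined[OF is' t'_in] by metis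
  with s t' show ?thesis by blast
qed

section \<open>The isomorphism and its uniqueness\<close>

definition link :: "'v \<Rightarrow> 'v" where
  "link b = (THE b'. B.linked B B' b b')"

lemma linked_link: "b \<in> B \<Longrightarrow> B.linked B B' b (link b)"
  unfolding link_def by (rule theI', rule linked_ex1)

lemma link_eqI: "B.linked B B' b b' \<Longrightarrow> link b = b'"
  using linked_link linked_unique linked_in by blast

text \<open>Unique existence of partners, applied with the bases exchanged, gives injectivity and
  surjectivity.\<close>

lemma bij_betw_link: "bij_betw link B B'"
proof -
  interpret swap: two_perfect_bases M I B' B by (rule swap)
  have "inj_on link B"
    using linked_link linked_sym swap.linked_unique by (metis inj_onI)
  moreover have "link ` B = B'"
    using linked_link linked_in link_eqI linked_sym swap.linked_ex1
    by (metis image_eqI subsetI subset_antisym image_subsetI)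
  ultimately show ?thesis by (simp add: bij_betw_def)
qed

text \<open>Domains match because undefinedness means \<open>ell\<close> zero, and linked elements
  share \<open>ell\<close>.\<close>

lemma e_tilde_link:
  assumes "i \<in> I" "b \<in> B"
  shows "e_tilde M B' i (link b) = map_option link (e_tilde M B i b)"
proof (cases "e_tilde M B i b")
  case None
  then show ?thesis
    using B.e_tilde_eq_None_iff[OF assms] B'.e_tilde_eq_None_iff[OF assms(1), of "link b"]
      linked_ell[OF linked_link[OF assms(2)] assms(1)] linked_in[OF linked_link[OF assms(2)]]
    by simp
next
  case (Some t)
  then show ?thesis
    using linked_e_tilde[OF linked_link[OF assms(2)] assms(1)] link_eqI by fastforce
qed

lemma based_hom_id: "based_hom I M B M B' id"
  unfolding based_hom_def
proof (intro conjI bexI[of _ link] bexI[of _ "\<lambda>b. B.representation B' b (link b)"] ballI impI)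
  show "module_hom I M M id"
    using B.vector_space_axioms by (simp add: module_hom_def Vector_Spaces.linear_iff)
  show "0 \<notin> id ` B" using B.nonzero_B by force
  show "link \<in> B \<rightarrow> B'" using linked_in[OF linked_link] by blast
  show "(\<lambda>b. B.representation B' b (link b)) \<in> B - B_plus I M B \<rightarrow> - {0}"
    using linked_link by (auto simp: B.linked_def)
  show "link b = id b" if "b \<in> B_plus I M B" for b
    using link_eqI[OF linked_B_plus[OF that]] by simp
  fix b "is"
  assume "b \<in> B - B_plus I M B" "is \<in> sequences I" "e_top_seq M is b \<in> V_plus I M"
  then show "prec M is (id b - scl M (B.representation B' b (link b)) (link b)) (id b)"
    using linked_prec[OF linked_link] by (simp add: sequences_def)
qed

lemma based_iso_id: "based_iso I M B M B' id"
proof -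
  interpret swap: two_perfect_bases M I B' B by (rule swap)
  show ?thesis
    unfolding based_iso_def using based_hom_id swap.based_hom_id by auto
qed

text \<open>Extensional function spaces fix the values outside the domains, which would otherwise be
  free and spoil uniqueness.\<close>

lemma based_map_unique:
  "\<exists>!(ft, c). ft \<in> B \<rightarrow>\<^sub>E B' \<and> c \<in> (B - B_plus I M B) \<rightarrow>\<^sub>E - {0} \<and>
     (\<forall>b\<in>B_plus I M B. ft b = b) \<and>
     (\<forall>b\<in>B - B_plus I M B. \<forall>is\<in>sequences I.
        e_tilde_top_seq M B is b \<in> Some ` B_plus I M B \<longrightarrow> prec M is (ft b - scl M (c b) b) b)"
  (is "\<exists>!(ft, c). ?P ft c")
proof -
  define f where "f = restrict link B"
  define k where "k = restrict (\<lambda>b. 1 / B.representation B' b (link b)) (B - B_plus I M B)"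
  have top: "e_tilde_top_seq M B is b \<in> Some ` B_plus I M B \<longleftrightarrow> e_top_seq M is b \<in> V_plus I M"
    if "is \<in> sequences I" "b \<in> B" for b "is"
    using top_in_V_plus_iff that by (simp add: sequences_def)
  have P_fk: "?P f k"
  proof (intro conjI ballI impI)
    show "f \<in> B \<rightarrow>\<^sub>E B'" using linked_in[OF linked_link] by (auto simp: f_def)
    show "k \<in> (B - B_plus I M B) \<rightarrow>\<^sub>E - {0}"
      using linked_link by (auto simp: k_def B.linked_def)
    show "f b = b" if "b \<in> B_plus I M B" for b
      using link_eqI[OF linked_B_plus[OF that]] that by (simp add: f_def B_plus_def)
    fix b "is"
    assume b: "b \<in> B - B_plus I M B" and sq: "is \<in> sequences I"
      "e_tilde_top_seq M B is b \<in> Some ` B_plus I M B"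
    then show "prec M is (f b - scl M (k b) b) b"
      using linked_prec_inverse[OF linked_link, of b "is"] top[of "is" b]
      by (simp add: f_def k_def sequences_def)
  qed
  have P_unique: "ft = f \<and> c = k" if P: "?P ft c" for ft c
  proof -
    have "ft b = f b" if "b \<in> B_plus I M B" for b
      using that P P_fk by simp
    moreover have "ft b = f b \<and> c b = k b" if b: "b \<in> B - B_plus I M B" for b
    proof -
      obtain "is" where sq: "is \<in> lists I" "e_top_seq M is b \<in> V_plus I M"
        using tops_reach B.nonzero_B[of b] b by (auto simp: tops_reach_V_plus_def)
      \<comment> \<open>With the empty sequence, b itself would lie in \<open>V_plus\<close> and
        hence in \<open>B_plus\<close>.\<close>
      have "is \<noteq> []" using sq(2) b by (auto simp: B_plus_def)
      then have "is \<in> sequences I" using sq(1) by (simp add: sequences_def)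
      then have "prec M is (ft b - scl M (c b) b) b" using P top sq(2) b by simp
      moreover have "ft b \<in> B'" "c b \<noteq> 0" using P b by (auto simp: PiE_iff)
      ultimately have "ft b = link b \<and> c b = 1 / B.representation B' b (link b)"
        using prec_determines[OF linked_link sq(1)] sq(2) b by blast
      then show ?thesis using b by (simp add: f_def k_def)
    qed
    ultimately have "\<And>b. b \<in> B \<Longrightarrow> ft b = f b" "\<And>b. b \<in> B - B_plus I M B \<Longrightarrow> c b = k b"
      by blast+
    then show ?thesis using P P_fk by (auto intro: PiE_ext)
  qed
  have "case (f, k) of (ft, c) \<Rightarrow> ?P ft c" unfolding prod.case by (rule P_fk)
  moreover have "x = (f, k)" if x: "case x of (ft, c) \<Rightarrow> ?P ft c" for x
  proof -
    obtain ft c where eq: "x = (ft, c)" by (cases x)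
    have "?P ft c" using x unfolding eq prod.case .
    then have "ft = f \<and> c = k" by (rule P_unique)
    then show ?thesis by (simp only: eq)
  qed
  ultimately show ?thesis by (rule ex1I)
qed

text \<open>As \<open>phi\<close> is computed from \<open>eps\<close> and the weight, it remains to
  compare weights. They agree because the partner of b occurs in the homogeneous vector b.\<close>

lemma crystal_iso_link:
  assumes "weight_decomposition I \<alpha> \<alpha>v M"
  shows "crystal_iso I (kashiwara_crystal \<alpha> M B) (kashiwara_crystal \<alpha> M B') link"
proof -
  have "weight M (link b) = weight M b" if b: "b \<in> B" for b
  proof -
    obtain \<mu> where "b \<in> weight_space M \<mu>" using B.homogeneous[OF b] by blast
    then show ?thesis
      using B'.weight_eq[OF assms B.nonzero_B[OF b]] linked_link[OF b]
      by (simp add: B.linked_def)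
  qed
  then show ?thesis
    using bij_betw_link e_tilde_link linked_ell[OF linked_link]
    by (simp add: crystal_iso_def kashiwara_crystal_def)
qed

end

theorem theorem5p37:
  fixes I :: "'i set"
    and \<alpha> :: "'i \<Rightarrow> 'l::fg_free_ab_group"
    and \<alpha>v :: "'i \<Rightarrow> 'l dual"
    and V :: "('i, 'l, 'v::ab_group_add) graded_module"
    and B B' :: "'v set"
  assumes "finite I"
    and "locally_finite_module I \<alpha> \<alpha>v V"
    and "locally_nilpotent I V"
    and "tops_reach_V_plus I V"
    and "perfect_basis I V B"
    and "perfect_basis I V B'"
    and "B_plus I V B' = B_plus I V B"
  shows "based_iso I V B V B' id \<and>
    (\<exists>!(ft, c). ft \<in> B \<rightarrow>\<^sub>E B' \<and> c \<in> (B - B_plus I V B) \<rightarrow>\<^sub>E - {0} \<and>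
       (\<forall>b\<in>B_plus I V B. ft b = b) \<and>
       (\<forall>b\<in>B - B_plus I V B. \<forall>is\<in>sequences I.
          e_tilde_top_seq V B is b \<in> Some ` B_plus I V B \<longrightarrow>
          prec V is (ft b - scl V (c b) b) b)) \<and>
    upper_normal I (kashiwara_crystal \<alpha> V B) \<and>
    upper_normal I (kashiwara_crystal \<alpha> V B') \<and>
    (\<exists>f. crystal_iso I (kashiwara_crystal \<alpha> V B) (kashiwara_crystal \<alpha> V B') f)"
proof -
  have "vector_space (scl V)"
    using assms(2) by (simp add: locally_finite_module_def is_module_def)
  then interpret two_perfect_bases V I B B'
    using assms(2-7)
    by (simp add: two_perfect_bases_def two_perfect_bases_axioms_def perfect_module_def
        perfect_module_axioms_def nilpotent_operators_def nilpotent_operators_axioms_def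
        locally_finite_module_def is_module_def)
  have "weight_decomposition I \<alpha> \<alpha>v V" using assms(2) by (simp add: locally_finite_module_def)
  then show ?thesis
    by (intro conjI exI[of _ link] based_iso_id based_map_unique crystal_iso_link
        B.upper_normal_kashiwara_crystal B'.upper_normal_kashiwara_crystal)
qed

end
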